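(* Let $L$ be a Lie algebra (not necessarily finite dimensional) over a field of characteristic $0$ and let $I$ be a solvable ideal of $L$ of derived length $n$. Then there exists a polynomial $f_n(x)$ (with real coefficients) of degree $n$ such that for every derivation $D\in \mathrm{Der}(L)$ and every nonnegative integer $k$ the ideal $I+D(I)+\cdots+D^{k}(I)$ of $L$ is solvable of derived length at most $f_n(k)$.
   Context: $\mathrm{Der}(L)$ is the set of all linear derivations of $L$ over the ground field. For a subspace $A\subseteq L$, $D^0(A)=A$ and $D^k(A)=D(D^{k-1}(A))$ for $k\ge1$. For any ideal $I$ of $L$, the subspace $I+D(I)+\cdots+D^k(I)$ is an ideal of $L$. The derived series of a Lie algebra $M$ is $M^{(0)}=M$, $M^{(k)}=[M^{(k-1)},M^{(k-1)}]$, where brackets of subspaces denote linear spans. The derived length of a solvable Lie algebra $M$ is the least $k\ge 0$ with $M^{(k)}=0$; in particular it is $0$ if and only if $M=0$. *)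

theory Defs
  imports
    Complex_Main
    "HOL-Library.Set_Algebras"
    "HOL-Computational_Algebra.Polynomial"
begin

(* The Lie algebra is the whole type 'v; subalgebras and ideals are sets of type 'v set. *)
locale lie_algebra = vector_space scale
  for scale :: "'k::field \<Rightarrow> 'v::ab_group_add \<Rightarrow> 'v" +
  fixes bracket :: "'v \<Rightarrow> 'v \<Rightarrow> 'v"
  assumes linear_bracket_left: "Vector_Spaces.linear scale scale (\<lambda>x. bracket x y)"
    and linear_bracket_right: "Vector_Spaces.linear scale scale (\<lambda>y. bracket x y)"
    and bracket_self: "bracket x x = 0"
    and jacobi: "bracket x (bracket y z) + bracket y (bracket z x) + bracket z (bracket x y) = 0"
begin

definition bracket_space :: "'v set \<Rightarrow> 'v set \<Rightarrow> 'v set" where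
  "bracket_space A B = span {bracket a b | a b. a \<in> A \<and> b \<in> B}"

(* Two-sided by antisymmetry of the bracket. *)
definition lie_ideal :: "'v set \<Rightarrow> bool" where
  "lie_ideal I \<longleftrightarrow> subspace I \<and> (\<forall>x. \<forall>a\<in>I. bracket x a \<in> I)"

definition Der :: "('v \<Rightarrow> 'v) set" where
  "Der = {D. Vector_Spaces.linear scale scale D \<and>
             (\<forall>x y. D (bracket x y) = bracket (D x) y + bracket x (D y))}"

primrec derived_series :: "'v set \<Rightarrow> nat \<Rightarrow> 'v set" where
  "derived_series M 0 = M"
| "derived_series M (Suc k) = bracket_space (derived_series M k) (derived_series M k)"

definition solvable :: "'v set \<Rightarrow> bool" where
  "solvable M \<longleftrightarrow> (\<exists>k. derived_series M k = {0})"

(* Only meaningful for solvable M; elsewhere LEAST is unspecified. *)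
definition derived_length :: "'v set \<Rightarrow> nat" where
  "derived_length M = (LEAST k. derived_series M k = {0})"

(* I + D(I) + ... + D^k(I), with + on sets the Minkowski sum. *)
definition derivation_sum :: "('v \<Rightarrow> 'v) \<Rightarrow> 'v set \<Rightarrow> nat \<Rightarrow> 'v set" where
  "derivation_sum D I k = (\<Sum>i\<le>k. ((`) D ^^ i) I)"

lemma derivation_sum_0 [simp]: "derivation_sum D I 0 = I"
  by (simp add: derivation_sum_def)

lemma derivation_sum_Suc:
  "derivation_sum D I (Suc k) = derivation_sum D I k + ((`) D ^^ Suc k) I"
  by (simp add: derivation_sum_def)

lemma funpow_image:
  fixes D :: "'v \<Rightarrow> 'v"
  shows "((`) D ^^ i) I = (D ^^ i) ` I"
  by (induction i) (simp_all add: image_comp)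

lemma subspace_set_plus:
  assumes "subspace A" "subspace B"
  shows "subspace (A + B)"
proof -
  have "A + B = {x + y | x y. x \<in> A \<and> y \<in> B}"
    by (auto simp: set_plus_def)
  then show ?thesis using subspace_sums[OF assms] by simp
qed

lemma lie_ideal_derivation_sum:
  assumes I: "lie_ideal I" and D: "D \<in> Der"
  shows "lie_ideal (derivation_sum D I k)"
proof -
  have lin: "Vector_Spaces.linear scale scale D"
    and leib: "\<And>x y. D (bracket x y) = bracket (D x) y + bracket x (D y)"
    using D by (auto simp: Der_def)
  interpret D: Vector_Spaces.linear scale scale D by (fact lin)
  have sI: "subspace I" using I by (simp add: lie_ideal_def)
  have sP: "subspace (((`) D ^^ i) I)" for i
    by (induction i) (auto simp: sI intro: D.subspace_image)
  have sS: "subspace (derivation_sum D I i)" for i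
    by (induction i) (auto simp: sI derivation_sum_Suc simp del: funpow.simps
        intro!: subspace_set_plus sP)
  have mono: "derivation_sum D I i \<subseteq> derivation_sum D I (Suc i)" for i
  proof
    fix x assume "x \<in> derivation_sum D I i"
    then have "x + 0 \<in> derivation_sum D I (Suc i)"
      unfolding derivation_sum_Suc by (intro set_plus_intro subspace_0 sP)
    then show "x \<in> derivation_sum D I (Suc i)" by simp
  qed
  have top: "((`) D ^^ i) I \<subseteq> derivation_sum D I i" for i
  proof (cases i)
    case (Suc j)
    show ?thesis
    proof
      fix x assume "x \<in> ((`) D ^^ i) I"
      then have "0 + x \<in> derivation_sum D I i"
        unfolding Suc derivation_sum_Suc by (intro set_plus_intro subspace_0 sS)
      then show "x \<in> derivation_sum D I i" by simp
    qed
  qed simp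
  have step: "D x \<in> derivation_sum D I (Suc i)" if "x \<in> derivation_sum D I i" for x i
    using that
  proof (induction i arbitrary: x)
    case 0
    then show ?case using top[of "Suc 0"] by auto
  next
    case (Suc i)
    from Suc.prems obtain u v where x: "x = u + v" and u: "u \<in> derivation_sum D I i"
      and v: "v \<in> ((`) D ^^ Suc i) I"
      unfolding derivation_sum_Suc by (rule set_plus_elim)
    have "D v \<in> ((`) D ^^ Suc (Suc i)) I" using v by auto
    with Suc.IH[OF u] show ?case
      unfolding x D.add derivation_sum_Suc[of D I "Suc i"] by (rule set_plus_intro)
  qed
  have br: "bracket x ((D ^^ i) a) \<in> derivation_sum D I i" if "a \<in> I" for x i a
  proof (induction i arbitrary: x)
    case 0
    then show ?case using I that by (simp add: lie_ideal_def)
  next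
    case (Suc i)
    have "bracket x ((D ^^ Suc i) a) = D (bracket x ((D ^^ i) a)) - bracket (D x) ((D ^^ i) a)"
      by (simp add: leib)
    also have "\<dots> \<in> derivation_sum D I (Suc i)"
      using step[OF Suc.IH] subsetD[OF mono Suc.IH] by (rule subspace_diff[OF sS])
    finally show ?case .
  qed
  have "bracket x a \<in> derivation_sum D I k" if "a \<in> derivation_sum D I k" for x a
    using that
  proof (induction k arbitrary: a)
    case 0
    then show ?case using I by (simp add: lie_ideal_def)
  next
    case (Suc k)
    interpret B: Vector_Spaces.linear scale scale "bracket x" by (rule linear_bracket_right)
    from Suc.prems obtain u v where a: "a = u + v" and u: "u \<in> derivation_sum D I k"
      and v: "v \<in> ((`) D ^^ Suc k) I"
      unfolding derivation_sum_Suc by (rule set_plus_elim)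
    from v obtain w where "w \<in> I" "v = (D ^^ Suc k) w" unfolding funpow_image by blast
    then have "bracket x v \<in> derivation_sum D I (Suc k)" using br by blast
    with Suc.IH[OF u] show ?case
      unfolding a B.add by (blast intro: subspace_add[OF sS] subsetD[OF mono])
  qed
  with sS show ?thesis by (simp add: lie_ideal_def)
qed

lemma derived_length_eq_0_iff:
  assumes "solvable M"
  shows "derived_length M = 0 \<longleftrightarrow> M = {0}"
proof -
  obtain k where "derived_series M k = {0}" using assms by (auto simp: solvable_def)
  then have "derived_series M (derived_length M) = {0}"
    unfolding derived_length_def by (rule LeastI)
  then show ?thesis
    by (metis (mono_tags, lifting) Least_eq_0 derived_length_def derived_series.simps(1))
qed

end

end

theory Submission
  imports Defs
begin

(* Write I_k = I + D(I) + ... + D^k(I) and J = [I, I].  For a, b in I, expanding D^(2k) [a, b]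
   by the Leibniz rule gives (2k choose k) [D^k a, D^k b] plus terms in I_(k-1), and the binomial
   coefficient is invertible in characteristic 0; hence [I_k, I_k] is contained in
   I_(k-1) + J_(2k).  Iterating, the (k+1)-st derived algebra of I_k lies in J_(2k), and since J
   has derived length n - 1, induction on n bounds the derived length of I_k by (2^n - 1) k + n,
   which is even linear in k. *)

context lie_algebra
begin

section \<open>Bilinear calculus of the bracket and ideals\<close>

lemma bracket_add_left: "bracket (x + y) z = bracket x z + bracket y z"
  and bracket_scale_left: "bracket (scale c x) z = scale c (bracket x z)"
proof -
  interpret B: Vector_Spaces.linear scale scale "\<lambda>x. bracket x z" by (rule linear_bracket_left)
  show "bracket (x + y) z = bracket x z + bracket y z" by (rule B.add)
  show "bracket (scale c x) z = scale c (bracket x z)" by (rule B.scale)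
qed

lemma bracket_add_right: "bracket x (y + z) = bracket x y + bracket x z"
  and bracket_scale_right: "bracket x (scale c y) = scale c (bracket x y)"
proof -
  interpret B: Vector_Spaces.linear scale scale "bracket x" by (rule linear_bracket_right)
  show "bracket x (y + z) = bracket x y + bracket x z" by (rule B.add)
  show "bracket x (scale c y) = scale c (bracket x y)" by (rule B.scale)
qed

lemma bracket_0_left [simp]: "bracket 0 y = 0"
  using bracket_add_left[of 0 0 y] by simp

lemma bracket_0_right [simp]: "bracket x 0 = 0"
  using bracket_add_right[of x 0 0] by simp

lemma bracket_antisym: "bracket x y = - bracket y x"
proof -
  have "bracket (x + y) (x + y) = bracket x y + bracket y x"
    unfolding bracket_add_left bracket_add_right by (simp add: bracket_self)
  then have "bracket x y + bracket y x = 0" by (simp only: bracket_self)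
  then show ?thesis by (simp only: eq_neg_iff_add_eq_0)
qed

lemma lie_ideal_bracket_left:
  assumes "lie_ideal I" "a \<in> I"
  shows "bracket a x \<in> I"
  using assms subspace_neg unfolding lie_ideal_def bracket_antisym[of a x] by blast

text \<open>Bilinearity, one argument at a time: first \<open>y\<close> varies over combinations
  with a generator on the left, then \<open>x\<close> does. All later inclusions of brackets are
  thereby checked on generators only.\<close>

lemma bracket_span_subset:
  assumes S: "subspace S"
    and gen: "\<And>a b. a \<in> A \<Longrightarrow> b \<in> B \<Longrightarrow> bracket a b \<in> S"
    and "x \<in> span A" "y \<in> span B"
  shows "bracket x y \<in> S"
proof -
  have right: "bracket a y \<in> S" if "a \<in> A" for a
    using \<open>y \<in> span B\<close>
  proof (induction rule: span_induct_alt)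
    case base
    then show ?case by (simp add: subspace_0[OF S])
  next
    case (step c b y)
    then show ?case
      using gen that S
      by (simp add: bracket_add_right bracket_scale_right subspace_add subspace_scale)
  qed
  show ?thesis
    using \<open>x \<in> span A\<close>
  proof (induction rule: span_induct_alt)
    case base
    then show ?case by (simp add: subspace_0[OF S])
  next
    case (step c a x)
    then show ?case
      using right S
      by (simp add: bracket_add_left bracket_scale_left subspace_add subspace_scale)
  qed
qed

lemma bracket_space_span_subset:
  assumes "subspace S" "\<And>a b. a \<in> A \<Longrightarrow> b \<in> B \<Longrightarrow> bracket a b \<in> S"
  shows "bracket_space (span A) (span B) \<subseteq> S"
  unfolding bracket_space_def
  using assms by (intro span_minimal) (auto intro: bracket_span_subset)

lemma bracket_space_mono:
  assumes "A \<subseteq> A'" "B \<subseteq> B'"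
  shows "bracket_space A B \<subseteq> bracket_space A' B'"
  unfolding bracket_space_def using assms by (intro span_mono) blast

lemma lie_ideal_bracket_space:
  assumes I: "lie_ideal I" and J: "lie_ideal J"
  shows "lie_ideal (bracket_space I J)"
  unfolding lie_ideal_def
proof (intro conjI allI ballI)
  let ?G = "{bracket a b | a b. a \<in> I \<and> b \<in> J}"
  show sub: "subspace (bracket_space I J)"
    unfolding bracket_space_def by (rule subspace_span)
  fix x c assume c: "c \<in> bracket_space I J"
  have gen: "bracket x (bracket a b) \<in> bracket_space I J" if "a \<in> I" "b \<in> J" for a b
  proof -
    \<comment> \<open>The Jacobi identity, read as saying that bracketing with \<open>x\<close> is a
      derivation; both summands are again generators because \<open>I\<close> and \<open>J\<close>
      are ideals.\<close>
    have "bracket x (bracket a b) = bracket a (bracket x b) + bracket (bracket x a) b"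
    proof -
      have "bracket a (bracket b x) = - bracket a (bracket x b)"
        using bracket_scale_right[of a "-1" "bracket x b"] bracket_antisym[of b x] by simp
      then show ?thesis
        using jacobi[of x a b] bracket_antisym[of b "bracket x a"]
        by (simp add: algebra_simps)
    qed
    moreover have "bracket a (bracket x b) \<in> ?G" "bracket (bracket x a) b \<in> ?G"
      using that I J unfolding lie_ideal_def by blast+
    ultimately show ?thesis
      unfolding bracket_space_def by (simp only: span_add span_base)
  qed
  show "bracket x c \<in> bracket_space I J"
    by (rule bracket_span_subset[OF sub, of "{x}" ?G])
       (use gen c in \<open>auto simp: bracket_space_def span_base\<close>)
qed

section \<open>The derived series\<close>

lemma derived_series_mono: "M \<subseteq> N \<Longrightarrow> derived_series M k \<subseteq> derived_series N k"
  by (induction k) (simp_all add: bracket_space_mono)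

lemma derived_series_add: "derived_series M (i + j) = derived_series (derived_series M i) j"
  by (induction j) simp_all

text \<open>The recursion in the definition peels off the last bracket. Peeling off the first one
  instead lets an induction replace \<open>M\<close> by \<open>bracket_space M M\<close>.\<close>

lemma derived_series_Suc_left:
  "derived_series M (Suc k) = derived_series (bracket_space M M) k"
  using derived_series_add[of M 1 k] by simp

lemma zero_in_derived_series: "0 \<in> M \<Longrightarrow> 0 \<in> derived_series M k"
  by (cases k) (simp_all add: bracket_space_def span_zero)

section \<open>Powers of a derivation\<close>

lemma subspace_derivation_image:
  assumes "D \<in> Der" "subspace I"
  shows "subspace ((D ^^ i) ` I)"
proof -
  have "Vector_Spaces.linear scale scale D" using assms(1) by (simp add: Der_def)
  then interpret D: Vector_Spaces.linear scale scale D .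
  show ?thesis
  proof (induction i)
    case (Suc i)
    then show ?case using D.subspace_image[of "(D ^^ i) ` I"] by (simp add: image_comp o_def)
  qed (simp add: assms)
qed

text \<open>Each summand is a subspace, hence its own span, and the span of a union is the sum of
  the spans. This form supplies the generators for \<open>bracket_span_subset\<close>.\<close>

lemma derivation_sum_eq_span:
  assumes "D \<in> Der" "subspace I"
  shows "derivation_sum D I k = span (\<Union>i\<le>k. (D ^^ i) ` I)"
proof (induction k)
  case 0
  then show ?case using assms by (simp add: span_eq_iff[THEN iffD2])
next
  case (Suc k)
  have "span ((D ^^ Suc k) ` I) = (D ^^ Suc k) ` I"
    using subspace_derivation_image[OF assms] by (simp only: span_eq_iff)
  then have "derivation_sum D I (Suc k)
      = span (\<Union>i\<le>k. (D ^^ i) ` I) + span ((D ^^ Suc k) ` I)"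
    unfolding derivation_sum_Suc Suc.IH funpow_image by (simp only:)
  also have "\<dots> = span ((\<Union>i\<le>k. (D ^^ i) ` I) \<union> (D ^^ Suc k) ` I)"
    unfolding span_Un by (auto simp: set_plus_def)
  finally show ?case by (simp only: atMost_Suc UN_insert Un_commute)
qed

lemma leibniz:
  assumes D: "D \<in> Der"
  shows "(D ^^ m) (bracket a b)
    = (\<Sum>i\<le>m. scale (of_nat (m choose i)) (bracket ((D ^^ i) a) ((D ^^ (m - i)) b)))"
proof (induction m)
  case 0
  then show ?case by simp
next
  case (Suc m)
  have lin: "Vector_Spaces.linear scale scale D"
    and der: "\<And>x y. D (bracket x y) = bracket (D x) y + bracket x (D y)"
    using D by (auto simp: Der_def)
  interpret D: Vector_Spaces.linear scale scale D by (fact lin)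
  define T where "T i j = bracket ((D ^^ i) a) ((D ^^ j) b)" for i j
  have DT: "D (T i j) = T (Suc i) j + T i (Suc j)" for i j
    by (simp add: T_def der)
  have "(D ^^ Suc m) (bracket a b) = D (\<Sum>i\<le>m. scale (of_nat (m choose i)) (T i (m - i)))"
    using Suc.IH by (simp add: T_def)
  also have "\<dots> = (\<Sum>i\<le>m. scale (of_nat (m choose i)) (T (Suc i) (m - i)))
      + (\<Sum>i\<le>m. scale (of_nat (m choose i)) (T i (Suc (m - i))))"
    by (simp add: D.sum D.scale DT scale_right_distrib sum.distrib)
  \<comment> \<open>The added term \<open>i = Suc m\<close> vanishes, since its binomial coefficient
    is 0. Splitting off \<open>i = 0\<close> afterwards leaves the index range of the other sum, so
    Pascal's rule applies termwise.\<close>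
  also have "(\<Sum>i\<le>m. scale (of_nat (m choose i)) (T i (Suc (m - i))))
      = (\<Sum>i\<le>Suc m. scale (of_nat (m choose i)) (T i (Suc m - i)))"
    by (simp add: Suc_diff_le binomial_eq_0)
  also have "\<dots> = T 0 (Suc m)
      + (\<Sum>i\<le>m. scale (of_nat (m choose Suc i)) (T (Suc i) (m - i)))"
    by (subst sum.atMost_Suc_shift) simp
  also have "(\<Sum>i\<le>m. scale (of_nat (m choose i)) (T (Suc i) (m - i))) + \<dots>
      = T 0 (Suc m) + (\<Sum>i\<le>m. scale (of_nat (Suc m choose Suc i)) (T (Suc i) (m - i)))"
    by (simp add: scale_left_distrib sum.distrib)
  also have "\<dots> = (\<Sum>i\<le>Suc m. scale (of_nat (Suc m choose i)) (T i (Suc m - i)))"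
    by (subst sum.atMost_Suc_shift) simp
  finally show ?case by (simp only: T_def)
qed

end

section \<open>Descent of the derived series in characteristic 0\<close>

locale lie_algebra_char_0 = lie_algebra scale bracket
  for scale :: "'k::field_char_0 \<Rightarrow> 'v::ab_group_add \<Rightarrow> 'v" and bracket
begin

text \<open>In the Leibniz expansion the two exponents add up to \<open>2 * k\<close>, so in every
  term except the middle one some exponent is below \<open>k\<close>. Modulo \<open>S\<close> only a
  multiple of the middle term survives.\<close>

lemma bracket_derivation_powers:
  assumes D: "D \<in> Der" and S: "subspace S"
    and top: "(D ^^ (2 * k)) (bracket a b) \<in> S"
    and lower: "\<And>i j. i < k \<or> j < k \<Longrightarrow> bracket ((D ^^ i) a) ((D ^^ j) b) \<in> S"
  shows "bracket ((D ^^ k) a) ((D ^^ k) b) \<in> S"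
proof -
  define t where
    "t i = scale (of_nat (2 * k choose i)) (bracket ((D ^^ i) a) ((D ^^ (2 * k - i)) b))" for i
  have "(D ^^ (2 * k)) (bracket a b) = (\<Sum>i\<le>2 * k. t i)"
    unfolding t_def by (rule leibniz[OF D])
  also have "\<dots> = t k + (\<Sum>i\<in>{..2 * k} - {k}. t i)"
    by (rule sum.remove) auto
  finally have "t k = (D ^^ (2 * k)) (bracket a b) - (\<Sum>i\<in>{..2 * k} - {k}. t i)"
    by simp
  moreover have "t i \<in> S" if "i \<in> {..2 * k} - {k}" for i
    unfolding t_def using that by (intro subspace_scale[OF S] lower) auto
  ultimately have "t k \<in> S"
    by (simp only: subspace_diff[OF S top] subspace_sum[OF S])
  \<comment> \<open>The central binomial coefficient is a nonzero natural number, hence invertible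
    in characteristic 0.\<close>
  then have "scale (inverse (of_nat (2 * k choose k))) (t k) \<in> S"
    by (rule subspace_scale[OF S])
  then show ?thesis by (simp add: t_def)
qed

text \<open>The proof descends along a filtration \<open>Q m\<close> from \<open>Q (Suc k)\<close>,
  which contains the derivation sum of \<open>I\<close>, to \<open>Q 0 = N\<close>. Each bracket
  lowers the index by one, which accounts for the \<open>Suc k\<close> steps.\<close>

lemma derived_series_derivation_sum_subset:
  assumes I: "lie_ideal I" and D: "D \<in> Der"
  shows "derived_series (derivation_sum D I k) (Suc k)
    \<subseteq> derivation_sum D (bracket_space I I) (2 * k)"
proof -
  define N where "N = derivation_sum D (bracket_space I I) (2 * k)"
  define Q where "Q m = span ((\<Union>i<m. (D ^^ i) ` I) \<union> N)" for m
  have sI: "subspace I" using I by (simp add: lie_ideal_def)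
  have J: "lie_ideal (bracket_space I I)" by (rule lie_ideal_bracket_space[OF I I])
  have N: "lie_ideal N" unfolding N_def by (rule lie_ideal_derivation_sum[OF J D])
  have sQ: "subspace (Q m)" for m unfolding Q_def by simp
  have NQ: "N \<subseteq> Q m" for m unfolding Q_def by (auto intro: span_base)
  have IQ: "derivation_sum D I i \<subseteq> Q m" if "i < m" for i m
    unfolding derivation_sum_eq_span[OF D sI] Q_def
    using that by (intro span_mono) fastforce
  \<comment> \<open>The bracket stays in the ideal \<open>derivation_sum D I i\<close>, which lies
    in \<open>Q m\<close> because \<open>i < m\<close>.\<close>
  have low: "bracket ((D ^^ i) a) y \<in> Q m" if "i < m" "a \<in> I" for i m a y
  proof -
    have "(D ^^ i) a \<in> derivation_sum D I i"
      unfolding derivation_sum_eq_span[OF D sI] using that by (auto intro: span_base)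
    then show ?thesis
      using lie_ideal_bracket_left[OF lie_ideal_derivation_sum[OF I D]] IQ[OF that(1)] by blast
  qed
  have low': "bracket y ((D ^^ i) a) \<in> Q m" if "i < m" "a \<in> I" for i m a y
    using subspace_neg[OF sQ low[OF that]] bracket_antisym[of y] by simp
  \<comment> \<open>At level \<open>m\<close> the exponent \<open>2 * m\<close> occurs; as
    \<open>m\<close> is at most \<open>k\<close>, a sum up to \<open>2 * k\<close> covers all levels
    with one \<open>N\<close>.\<close>
  have top: "(D ^^ i) (bracket a b) \<in> Q m" if "i \<le> 2 * k" "a \<in> I" "b \<in> I" for i a b m
  proof -
    have "bracket a b \<in> bracket_space I I"
      unfolding bracket_space_def using that by (auto intro: span_base)
    then have "(D ^^ i) (bracket a b) \<in> N"
      unfolding N_def using that J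
      by (subst derivation_sum_eq_span[OF D]) (auto simp: lie_ideal_def intro!: span_base)
    then show ?thesis using NQ by blast
  qed
  have step: "bracket_space (Q (Suc m)) (Q (Suc m)) \<subseteq> Q m" if "m \<le> k" for m
    unfolding Q_def[of "Suc m"]
  proof (rule bracket_space_span_subset[OF sQ])
    fix x y
    assume x: "x \<in> (\<Union>i<Suc m. (D ^^ i) ` I) \<union> N" and y: "y \<in> (\<Union>i<Suc m. (D ^^ i) ` I) \<union> N"
    show "bracket x y \<in> Q m"
    \<comment> \<open>The ideal \<open>N\<close> absorbs brackets. Of the remaining generators, a
      pair with an exponent below \<open>m\<close> falls to \<open>low\<close> or
      \<open>low'\<close>, and the pair with both exponents \<open>m\<close> needs the binomial
      argument.\<close>
    proof (cases "x \<in> N \<or> y \<in> N")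
      case True
      then have "bracket x y \<in> N"
        using N lie_ideal_bracket_left[OF N] by (auto simp: lie_ideal_def)
      then show ?thesis using NQ by blast
    next
      case False
      with x y obtain i j a b where ab: "a \<in> I" "b \<in> I"
        and ij: "i \<le> m" "j \<le> m" and xy: "x = (D ^^ i) a" "y = (D ^^ j) b"
        by (auto simp: less_Suc_eq_le)
      show ?thesis
      proof (cases "i < m \<or> j < m")
        case True
        then show ?thesis using low low' ab xy by blast
      next
        case False
        with ij have "i = m" "j = m" by auto
        moreover have "bracket ((D ^^ m) a) ((D ^^ m) b) \<in> Q m"
          using \<open>m \<le> k\<close> ab
          by (intro bracket_derivation_powers[OF D sQ]) (auto intro: top low low')
        ultimately show ?thesis using xy by simp
      qed
    qed
  qed
  have "derived_series (Q m) m \<subseteq> N" if "m \<le> Suc k" for m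
    using that
  proof (induction m)
    case 0
    then show ?case using N by (simp add: Q_def lie_ideal_def span_eq_iff[THEN iffD2])
  next
    case (Suc m)
    then show ?case
      using derived_series_mono[OF step, of m m] unfolding derived_series_Suc_left by simp
  qed
  then have "derived_series (Q (Suc k)) (Suc k) \<subseteq> N" by blast
  then show ?thesis
    using derived_series_mono[OF IQ[of k "Suc k"], of "Suc k"] unfolding N_def by blast
qed

text \<open>The exponent r(n, k) solves r(0, k) = 0 and r(n + 1, k) = (k + 1) + r(n, 2k). The
  induction keeps \<open>k\<close> arbitrary because passing to \<open>bracket_space I I\<close>
  doubles it.\<close>

lemma derived_series_derivation_sum_eq_0:
  assumes "lie_ideal I" "derived_series I n = {0}" and D: "D \<in> Der"
  shows "derived_series (derivation_sum D I k) ((2 ^ n - 1) * k + n) = {0}"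
  using assms(1,2)
proof (induction n arbitrary: I k)
  case 0
  then have "I = {0}" by simp
  have "Vector_Spaces.linear scale scale D" using D by (simp add: Der_def)
  then interpret D: Vector_Spaces.linear scale scale D .
  have "(D ^^ i) 0 = 0" for i by (induction i) simp_all
  then show ?case
    using \<open>I = {0}\<close> D by (simp add: derivation_sum_eq_span UN_constant_eq span_insert_0)
next
  case (Suc n)
  let ?N = "derivation_sum D (bracket_space I I) (2 * k)"
  let ?r = "(2 ^ n - 1) * (2 * k) + n"
  have "derived_series ?N ?r = {0}"
    using Suc.IH[of "bracket_space I I"] Suc.prems lie_ideal_bracket_space
    by (simp add: derived_series_Suc_left del: derived_series.simps)
  then have "derived_series (derivation_sum D I k) (Suc k + ?r) \<subseteq> {0}"
    unfolding derived_series_add[of _ "Suc k"]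
    using derived_series_mono[OF derived_series_derivation_sum_subset[OF Suc.prems(1) D], of k ?r]
    by (simp only:)
  moreover have "0 \<in> derived_series (derivation_sum D I k) (Suc k + ?r)"
    using lie_ideal_derivation_sum[OF Suc.prems(1) D] subspace_0
    unfolding lie_ideal_def by (intro zero_in_derived_series) blast
  moreover have "Suc k + ?r = (2 ^ Suc n - 1) * k + Suc n"
  proof -
    \<comment> \<open>Writing the power as a successor removes the truncated subtraction.\<close>
    obtain q :: nat where "2 ^ n = Suc q" using not0_implies_Suc[of "2 ^ n"] by auto
    then show ?thesis by (simp add: algebra_simps)
  qed
  ultimately show ?case by (metis subset_singletonD empty_iff)
qed

end

section \<open>A polynomial of the prescribed degree\<close>

theorem theorem3:
  fixes n :: nat
  shows "\<exists>f :: real poly. f \<noteq> 0 \<and> degree f = n \<and>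
    (\<forall>(scale :: 'k::field_char_0 \<Rightarrow> 'v::ab_group_add \<Rightarrow> 'v) bracket I.
      lie_algebra scale bracket \<longrightarrow>
      lie_algebra.lie_ideal scale bracket I \<longrightarrow>
      lie_algebra.solvable scale bracket I \<longrightarrow>
      lie_algebra.derived_length scale bracket I = n \<longrightarrow>
      (\<forall>D \<in> lie_algebra.Der scale bracket. \<forall>k :: nat.
        lie_algebra.solvable scale bracket (lie_algebra.derivation_sum D I k) \<and>
        real (lie_algebra.derived_length scale bracket (lie_algebra.derivation_sum D I k))
          \<le> poly f (real k)))"
\<comment> \<open>The bound \<open>(2 ^ n - 1) * k + n\<close> is linear in \<open>k\<close>,
  whereas degree exactly \<open>n\<close> is required; 2^n (1 + x)^n has that degree and dominates
  the bound for every \<open>k\<close>.\<close>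
proof (intro exI[of _ "smult (2 ^ n) ([:1, 1:] ^ n)"] conjI allI impI ballI)
  let ?f = "smult (2 ^ n) ([:1, 1:] ^ n) :: real poly"
  show "?f \<noteq> 0" by simp
  show "degree ?f = n" by (simp add: degree_linear_power)
  fix scale :: "'k \<Rightarrow> 'v \<Rightarrow> 'v" and bracket I D and k :: nat
  assume "lie_algebra scale bracket"
    and I: "lie_algebra.lie_ideal scale bracket I"
    and sol: "lie_algebra.solvable scale bracket I"
    and dl: "lie_algebra.derived_length scale bracket I = n"
    and D: "D \<in> lie_algebra.Der scale bracket"
  then interpret lie_algebra_char_0 scale bracket by (simp add: lie_algebra_char_0_def)
  let ?r = "(2 ^ n - 1) * k + n"
  have "derived_series I n = {0}"
    using sol dl LeastI_ex[of "\<lambda>k. derived_series I k = {0}"]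
    by (auto simp: solvable_def derived_length_def)
  then have zero: "derived_series (derivation_sum D I k) ?r = {0}"
    by (rule derived_series_derivation_sum_eq_0[OF I _ D])
  then show "solvable (derivation_sum D I k)" by (auto simp: solvable_def)
  have "derived_length (derivation_sum D I k) \<le> ?r"
    unfolding derived_length_def by (rule Least_le) (rule zero)
  also have "?r \<le> 2 ^ n * (1 + k) ^ n"
  \<comment> \<open>For positive \<open>n\<close> the estimate uses n < 2^n and 1 + k <= (1 + k)^n.
    The latter comes from monotonicity in the exponent, which needs \<open>n\<close> at least 1; for
    \<open>n = 0\<close> the left side is 0.\<close>
  proof (cases n)
    case (Suc m)
    have "?r \<le> 2 ^ n * k + 2 ^ n"
      using less_exp[of n] by (intro add_mono mult_right_mono) auto
    also have "\<dots> \<le> 2 ^ n * (1 + k) ^ n"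
      using power_increasing[of 1 n "1 + k"] Suc mult_le_mono2[of "1 + k" "(1 + k) ^ n" "2 ^ n"]
      by (simp add: algebra_simps del: power_Suc)
    finally show ?thesis .
  qed simp
  finally have "real (derived_length (derivation_sum D I k)) \<le> real (2 ^ n * (1 + k) ^ n)"
    by (rule of_nat_mono)
  then show "real (derived_length (derivation_sum D I k)) \<le> poly ?f (real k)"
    by (simp add: poly_power)
qed

end
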